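(* For each $N\ge1$ there exists a positive integer $K=K(N)$ depending only on $N$ such that for every $H=(H_1,\dots,H_N)\in(0,1)^N$, any integer $n\ge1$ and any distinct points $s^0,s^1,\dots,s^n\in\mathbb{R}^N$, the cardinality of the set of all $j\in\{1,\dots,n\}$ such that \[ \tilde\rho(s^j,s^0)=\min\{\tilde\rho(s^j,s^i):0\le i\le n,\ i\ne j\} \] is at most $K$, where $\tilde\rho(t,s)=\max_{1\le p\le N}|t_p-s_p|^{H_p}$.
   Context: Superscripts index points of $\mathbb{R}^N$ and subscripts index coordinates. *)

theory Defs
  imports Complex_Main "HOL-Library.FuncSet"
begin

text \<open>Points of R^N are the extensional functions on \<open>{1..N}\<close>, so that equality of
  such functions is equality of points and \<open>N\<close> may be quantified over.\<close>

definition points :: "nat \<Rightarrow> (nat \<Rightarrow> real) set" where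
  "points N = {1..N} \<rightarrow>\<^sub>E UNIV"

text \<open>Since \<open>0 powr a = 0\<close>, the term for a coordinate in which \<open>t\<close> and \<open>s\<close> agree
  is \<open>0\<close>, as intended for positive exponents. For \<open>N = 0\<close> the maximum is unspecified.\<close>

definition rho_tilde :: "nat \<Rightarrow> (nat \<Rightarrow> real) \<Rightarrow> (nat \<Rightarrow> real) \<Rightarrow> (nat \<Rightarrow> real) \<Rightarrow> real" where
  "rho_tilde N H t s = (MAX p\<in>{1..N}. \<bar>t p - s p\<bar> powr H p)"

end

theory Submission
  imports Defs
begin

text \<open>Translate \<open>s 0\<close> to the origin. If two points other than the origin have the same sign
  vector in \<open>{-1, 0, 1}^N\<close>, then in each coordinate their difference is strictly smaller than the
  larger of the two coordinates in absolute value, or both coordinates vanish. So they are closer to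
  each other than the farther one is to the origin, and that one does not have \<open>s 0\<close> as a nearest
  neighbour. Hence the indices in question have distinct sign vectors, and \<open>K = 3 ^ N\<close> works.\<close>

lemma rho_tilde_less_iff:
  assumes "N \<ge> 1"
  shows "rho_tilde N H t s < r \<longleftrightarrow> (\<forall>p\<in>{1..N}. \<bar>t p - s p\<bar> powr H p < r)"
  unfolding rho_tilde_def using assms by simp

lemma powr_le_rho_tilde:
  assumes "p \<in> {1..N}"
  shows "\<bar>t p - s p\<bar> powr H p \<le> rho_tilde N H t s"
  unfolding rho_tilde_def using assms by (intro Max_ge) auto

lemma rho_tilde_commute: "rho_tilde N H t s = rho_tilde N H s t"
  by (simp add: rho_tilde_def abs_minus_commute)

lemma rho_tilde_pos:
  assumes "t \<in> points N" "s \<in> points N" "t \<noteq> s"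
  shows "rho_tilde N H t s > 0"
proof -
  \<comment> \<open>Points are extensional, so distinct ones must differ at an index inside
    \<open>{1..N}\<close>.\<close>
  obtain p where p: "p \<in> {1..N}" "t p \<noteq> s p"
    using assms unfolding points_def by (meson PiE_ext)
  then have "0 < \<bar>t p - s p\<bar> powr H p"
    by simp
  also have "\<dots> \<le> rho_tilde N H t s"
    using p(1) by (rule powr_le_rho_tilde)
  finally show ?thesis .
qed

text \<open>Both numbers are nonzero and lie on the same side of 0, so their distance is the larger
  absolute value minus the smaller, which is positive.\<close>

lemma abs_diff_less_max_of_sgn_eq:
  fixes a b :: real
  assumes "sgn a = sgn b" "a \<noteq> 0"
  shows "\<bar>a - b\<bar> < max \<bar>a\<bar> \<bar>b\<bar>"
  using assms by (auto simp: sgn_if max_def split: if_splits)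

lemma rho_tilde_less_max_of_sgn_eq:
  assumes "N \<ge> 1" and H: "\<And>p. p \<in> {1..N} \<Longrightarrow> H p > 0"
    and points: "t \<in> points N" "u \<in> points N" "v \<in> points N" and "t \<noteq> v"
    and sgn: "\<And>p. p \<in> {1..N} \<Longrightarrow> sgn (t p - v p) = sgn (u p - v p)"
  shows "rho_tilde N H t u < max (rho_tilde N H t v) (rho_tilde N H u v)"
    (is "_ < ?r")
  unfolding rho_tilde_less_iff[OF \<open>N \<ge> 1\<close>]
proof
  fix p assume p: "p \<in> {1..N}"
  let ?a = "t p - v p" and ?b = "u p - v p"
  show "\<bar>t p - u p\<bar> powr H p < ?r"
  proof (cases "?a = 0")
    case True
    then have "t p = u p"
      using sgn[OF p] by (simp add: sgn_if split: if_splits)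
    then show ?thesis
      \<comment> \<open>This coordinate contributes \<open>0 powr H p = 0\<close>, so the strict
        bound amounts to \<open>?r > 0\<close>; this is where \<open>t \<noteq> v\<close>
        enters.\<close>
      using rho_tilde_pos[of t N v H] points \<open>t \<noteq> v\<close> by (simp add: less_max_iff_disj)
  next
    case False
    have "\<bar>?a - ?b\<bar> < max \<bar>?a\<bar> \<bar>?b\<bar>"
      using sgn[OF p] False by (rule abs_diff_less_max_of_sgn_eq)
    then have "\<bar>t p - u p\<bar> < \<bar>?a\<bar> \<or> \<bar>t p - u p\<bar> < \<bar>?b\<bar>"
      by (simp add: less_max_iff_disj)
    \<comment> \<open>As \<open>H p > 0\<close>, the map \<open>x powr H p\<close> is strictly
      increasing on \<open>x \<ge> 0\<close>.\<close>
    then have "\<bar>t p - u p\<bar> powr H p < \<bar>?a\<bar> powr H p \<or> \<bar>t p - u p\<bar> powr H p < \<bar>?b\<bar> powr H p"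
      using H[OF p] by (auto intro: powr_less_mono2)
    then show ?thesis
      using powr_le_rho_tilde[OF p, of t v H] powr_le_rho_tilde[OF p, of u v H] by linarith
  qed
qed

theorem lemma2p6:
  fixes N :: nat
  assumes "N \<ge> 1"
  shows "\<exists>K::nat. K \<ge> 1 \<and>
    (\<forall>H \<in> {1..N} \<rightarrow>\<^sub>E {0<..<1::real}. \<forall>n::nat. \<forall>s :: nat \<Rightarrow> nat \<Rightarrow> real.
      n \<ge> 1 \<longrightarrow> (\<forall>i\<in>{0..n}. s i \<in> points N) \<longrightarrow> inj_on s {0..n} \<longrightarrow>
      card {j \<in> {1..n}. rho_tilde N H (s j) (s 0)
                        = Min {rho_tilde N H (s j) (s i) | i. 0 \<le> i \<and> i \<le> n \<and> i \<noteq> j}} \<le> K)"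
proof (intro exI conjI ballI allI impI)
  show "(1::nat) \<le> 3 ^ N"
    by simp
next
  fix H n and s :: "nat \<Rightarrow> nat \<Rightarrow> real"
  assume H: "H \<in> {1..N} \<rightarrow>\<^sub>E {0<..<1::real}"
    and s: "\<forall>i\<in>{0..n}. s i \<in> points N" and inj: "inj_on s {0..n}"
  define J where "J = {j \<in> {1..n}. rho_tilde N H (s j) (s 0)
      = Min {rho_tilde N H (s j) (s i) | i. 0 \<le> i \<and> i \<le> n \<and> i \<noteq> j}}"
  \<comment> \<open>Restricting the sign vector to \<open>{1..N}\<close> makes it extensional, hence
    an element of the finite product \<open>S\<close>.\<close>
  define \<sigma> where "\<sigma> j = (\<lambda>p\<in>{1..N}. sgn (s j p - s 0 p))" for j
  define S where "S = {1..N} \<rightarrow>\<^sub>E {-1, 0, 1::real}"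
  have nearest: "rho_tilde N H (s j) (s 0) \<le> rho_tilde N H (s j) (s i)"
    if "j \<in> J" "i \<le> n" "i \<noteq> j" for i j
    using that unfolding J_def by (auto intro!: Min_le)
  have "inj_on \<sigma> J"
  proof (rule inj_onI, rule ccontr)
    fix i j
    assume ij: "i \<in> J" "j \<in> J" "\<sigma> i = \<sigma> j" "i \<noteq> j"
    have le: "1 \<le> i" "i \<le> n" "1 \<le> j" "j \<le> n"
      using ij by (auto simp: J_def)
    have "rho_tilde N H (s i) (s j)
        < max (rho_tilde N H (s i) (s 0)) (rho_tilde N H (s j) (s 0))"
    proof (rule rho_tilde_less_max_of_sgn_eq[OF assms])
      show "s i \<noteq> s 0"
        using inj_onD[OF inj, of i 0] le by auto
      show "sgn (s i p - s 0 p) = sgn (s j p - s 0 p)" if "p \<in> {1..N}" for p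
        using fun_cong[OF ij(3), of p] that by (simp add: \<sigma>_def)
    qed (use H s le in \<open>auto simp: PiE_iff\<close>)
    \<comment> \<open>Since \<open>i\<close> and \<open>j\<close> both lie in \<open>J\<close>, each
      term of the maximum is at most the distance from \<open>s i\<close> to \<open>s j\<close>,
      whichever term is larger.\<close>
    moreover have "rho_tilde N H (s i) (s 0) \<le> rho_tilde N H (s i) (s j)"
      using nearest ij le by simp
    moreover have "rho_tilde N H (s j) (s 0) \<le> rho_tilde N H (s i) (s j)"
      using nearest[of j i] ij le by (simp add: rho_tilde_commute)
    ultimately show False
      by simp
  qed
  moreover have "\<sigma> ` J \<subseteq> S"
    by (auto simp: \<sigma>_def S_def sgn_if split: if_splits)
  moreover have "finite S"
    unfolding S_def by (intro finite_PiE) auto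
  ultimately have "card J \<le> card S"
    by (rule card_inj_on_le)
  also have "card S = 3 ^ N"
    by (simp add: S_def card_PiE numeral_3_eq_3)
  finally show "card J \<le> 3 ^ N" .
qed

end
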